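(* Let $(\Omega,\mathcal{F},\mathbb{P})$ be a probability space, $\mathcal{I}\subset\mathbb{R}$ an interval, and $f:\mathcal{I}\to\mathbb{R}$ a strictly increasing continuous function. Let $X\in\mathcal{L}_f^2$ and let $\mathcal{G}$ be a sub-$\sigma$-algebra of $\mathcal{F}$. Then there is a unique (up to $\mathbb{P}$-null sets) $\mathcal{G}$-measurable random variable $X^*$ such that $$X^*=\operatorname{argmin}\{d_f(X,Y)^2 \mid Y\in\mathcal{L}_f^2(\mathcal{G})\}.$$ It can be computed as $$X^*=f^{-1}\big(E[f(X)\mid\mathcal{G}]\big).$$
   Context: $E$ denotes expectation with respect to $\mathbb{P}$. For $p\ge1$ and a $\sigma$-algebra $\mathcal{H}\subset\mathcal{F}$, $\mathcal{L}_f^p(\mathcal{H})$ is the set of $\mathcal{I}$-valued $\mathcal{H}$-measurable random variables $Y$ with $E[|f(Y)|^p]<\infty$, and $\mathcal{L}_f^p=\mathcal{L}_f^p(\mathcal{F})$; random variables are identified when they agree $\mathbb{P}$-almost surely. For $X,Y\in\mathcal{L}_f^2$, the $f$-distance is defined by $d_f(X,Y)^2=E\big[(f(X)-f(Y))^2\big]$. The inverse $f^{-1}$ is defined on the interval $f(\mathcal{I})$. *)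

theory Defs
  imports "HOL-Probability.Probability"
begin

text \<open>
  The probability measure is always that of \<open>M\<close>; the second argument \<open>H\<close> only contributes its
  sigma-algebra. Elements are functions rather than almost-sure equivalence classes. Values of
  \<open>f\<close> outside \<open>I\<close> are irrelevant: measurability into \<open>restrict_space borel I\<close> forces \<open>Y\<close> to be
  \<open>I\<close>-valued on \<open>space H\<close>.
\<close>

definition Lf_space ::
  "'a measure \<Rightarrow> 'a measure \<Rightarrow> real set \<Rightarrow> (real \<Rightarrow> real) \<Rightarrow> real \<Rightarrow> ('a \<Rightarrow> real) set" where
  "Lf_space M H I f p =
    {Y \<in> measurable H (restrict_space borel I). integrable M (\<lambda>\<omega>. \<bar>f (Y \<omega>)\<bar> powr p)}"

definition f_dist ::
  "'a measure \<Rightarrow> (real \<Rightarrow> real) \<Rightarrow> ('a \<Rightarrow> real) \<Rightarrow> ('a \<Rightarrow> real) \<Rightarrow> real" where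
  "f_dist M f X Y = sqrt (\<integral>\<omega>. (f (X \<omega>) - f (Y \<omega>))\<^sup>2 \<partial>M)"

end

theory Submission
  imports Defs
begin

text \<open>
  The map \<open>Y \<mapsto> f \<circ> Y\<close> turns the \<open>f\<close>-distance into the ordinary \<open>L\<^sup>2\<close>-distance, so the problem is
  to approximate \<open>f \<circ> X\<close> in \<open>L\<^sup>2\<close> by \<open>G\<close>-measurable functions of the form \<open>f \<circ> Y\<close>. Among all
  square integrable \<open>G\<close>-measurable functions the best approximation is the conditional expectation
  \<open>C = E[f(X) | G]\<close>, because \<open>f \<circ> X - C\<close> is orthogonal to every such function. Lemma
  \<open>real_cond_exp_pythagoras\<close> expresses this as
  \<open>E[(f(X) - f(Y))\<^sup>2] = E[(f(X) - C)\<^sup>2] + E[(C - f(Y))\<^sup>2]\<close>,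
  where only the last term depends on \<open>Y\<close>. It vanishes exactly when \<open>f(Y) = C\<close> almost surely, and
  since \<open>f\<close> is injective on \<open>I\<close> this determines \<open>Y\<close> up to null sets.

  It remains to see that \<open>C\<close> is itself of the form \<open>f \<circ> Y\<close>. The image \<open>f ` I\<close> of an interval under a
  continuous map is an interval, and an average of values in an interval stays in it
  (\<open>real_cond_exp_in_interval\<close>); so \<open>C\<close> lies in \<open>f ` I\<close> almost surely. The inverse of \<open>f\<close> is monotone,
  hence Borel measurable (\<open>measurable_the_inv_into_strict_mono\<close>), and composing it with \<open>C\<close> gives an
  \<open>I\<close>-valued \<open>G\<close>-measurable function.
\<close>

lemma integrable_mult_L2:
  fixes g h :: "'a \<Rightarrow> real"
  assumes [measurable]: "g \<in> borel_measurable M" "h \<in> borel_measurable M"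
    and "integrable M (\<lambda>x. (g x)\<^sup>2)" "integrable M (\<lambda>x. (h x)\<^sup>2)"
  shows "integrable M (\<lambda>x. g x * h x)"
proof (rule Bochner_Integration.integrable_bound)
  show "integrable M (\<lambda>x. (g x)\<^sup>2 + (h x)\<^sup>2)"
    using assms by simp
  have "\<bar>a * b\<bar> \<le> \<bar>a\<^sup>2 + b\<^sup>2\<bar>" for a b :: real
  proof -
    have "2 * (\<bar>a\<bar> * \<bar>b\<bar>) \<le> a\<^sup>2 + b\<^sup>2"
      using sum_squares_bound[of "\<bar>a\<bar>" "\<bar>b\<bar>"] by (simp add: mult.assoc)
    moreover have "0 \<le> \<bar>a\<bar> * \<bar>b\<bar>" by simp
    ultimately show ?thesis unfolding abs_mult by linarith
  qed
  then show "AE x in M. norm (g x * h x) \<le> norm ((g x)\<^sup>2 + (h x)\<^sup>2)"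
    by simp
qed measurable

text \<open>
  Each end of the interval is treated on its own. An end that is absent imposes no condition; one that
  belongs to \<open>J\<close> gives a weak bound on \<open>Y\<close>, and one that does not belong to \<open>J\<close> gives a strict bound.
  Conditional expectation preserves both kinds of bound, so almost surely there are points of \<open>J\<close>
  on both sides of its value.
\<close>

lemma (in prob_space) real_cond_exp_in_interval:
  fixes Y :: "'a \<Rightarrow> real" and J :: "real set"
  assumes sub: "subalgebra M G" and J: "is_interval J"
    and Y: "integrable M Y" "\<And>\<omega>. \<omega> \<in> space M \<Longrightarrow> Y \<omega> \<in> J"
  shows "AE \<omega> in M. real_cond_exp M G Y \<omega> \<in> J"
proof -
  interpret finite_measure_subalgebra M G
    by unfold_locales (rule sub)
  have J_ne: "J \<noteq> {}"
    using Y(2) not_empty by auto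
  have upper: "AE \<omega> in M. \<exists>j\<in>J. real_cond_exp M G Y \<omega> \<le> j"
  proof (cases "bdd_above J")
    case False
    then show ?thesis
      by (intro always_eventually) (auto simp: bdd_above_def not_le intro: less_imp_le)
  next
    case True
    show ?thesis
    proof (cases "Sup J \<in> J")
      case True
      have "AE \<omega> in M. real_cond_exp M G Y \<omega> \<le> Sup J"
        using Y \<open>bdd_above J\<close> by (intro real_cond_exp_le_c) (auto intro: cSup_upper)
      with True show ?thesis by auto
    next
      case False
      have "Y \<omega> < Sup J" if "\<omega> \<in> space M" for \<omega>
        using cSup_upper[OF Y(2)[OF that] \<open>bdd_above J\<close>] Y(2)[OF that] False
        by (metis order_le_less)
      then have "AE \<omega> in M. real_cond_exp M G Y \<omega> < Sup J"
        using Y(1) by (intro real_cond_exp_less_c) auto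
      then show ?thesis
        by eventually_elim (use less_cSup_iff[OF J_ne \<open>bdd_above J\<close>] in \<open>auto intro: less_imp_le\<close>)
    qed
  qed
  have lower: "AE \<omega> in M. \<exists>j\<in>J. j \<le> real_cond_exp M G Y \<omega>"
  proof (cases "bdd_below J")
    case False
    then show ?thesis
      by (intro always_eventually) (auto simp: bdd_below_def not_le intro: less_imp_le)
  next
    case True
    show ?thesis
    proof (cases "Inf J \<in> J")
      case True
      have "AE \<omega> in M. Inf J \<le> real_cond_exp M G Y \<omega>"
        using Y \<open>bdd_below J\<close> by (intro real_cond_exp_ge_c) (auto intro: cInf_lower)
      with True show ?thesis by auto
    next
      case False
      have "Inf J < Y \<omega>" if "\<omega> \<in> space M" for \<omega>
        using cInf_lower[OF Y(2)[OF that] \<open>bdd_below J\<close>] Y(2)[OF that] False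
        by (metis order_le_less)
      then have "AE \<omega> in M. Inf J < real_cond_exp M G Y \<omega>"
        using Y(1) by (intro real_cond_exp_gr_c) auto
      then show ?thesis
        by eventually_elim (use cInf_less_iff[OF J_ne \<open>bdd_below J\<close>] in \<open>auto intro: less_imp_le\<close>)
    qed
  qed
  from upper lower show ?thesis
    by eventually_elim (use J mem_is_interval_1_I in blast)
qed

lemma (in prob_space) square_integrable_imp_integrable:
  fixes Y :: "'a \<Rightarrow> real"
  assumes "Y \<in> borel_measurable M" "integrable M (\<lambda>\<omega>. (Y \<omega>)\<^sup>2)"
  shows "integrable M Y"
  using integrable_mult_L2[of Y M "\<lambda>_. 1"] assms by simp

text \<open>Jensen's inequality gives \<open>E[Y|G]\<^sup>2 \<le> E[Y\<^sup>2|G]\<close>, whose right-hand side is integrable.\<close>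

lemma (in prob_space) real_cond_exp_L2:
  fixes Y :: "'a \<Rightarrow> real"
  assumes sub: "subalgebra M G" and Y [measurable]: "Y \<in> borel_measurable M"
    and Y2: "integrable M (\<lambda>\<omega>. (Y \<omega>)\<^sup>2)"
  shows "integrable M (\<lambda>\<omega>. (real_cond_exp M G Y \<omega>)\<^sup>2)"
proof -
  interpret finite_measure_subalgebra M G
    by unfold_locales (rule sub)
  have sq: "convex_on UNIV (\<lambda>x::real. x\<^sup>2)"
    by (rule convex_power2)
  show ?thesis
    by (rule integrable_convex_cond_exp[where X = Y and q = "\<lambda>x. x\<^sup>2" and I = UNIV])
       (use square_integrable_imp_integrable[OF Y Y2] Y2 sq in auto)
qed

text \<open>
  Conditional expectation is the orthogonal projection of \<open>L\<^sup>2\<close> onto the \<open>G\<close>-measurable functions: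
  the second claim is Pythagoras' theorem for the right-angled triangle with corners
  \<open>Y\<close>, \<open>E[Y|G]\<close> and \<open>h\<close>. The first claim makes its last integral meaningful, so that a zero value
  forces \<open>h = E[Y|G]\<close> almost everywhere.
\<close>

lemma (in prob_space) real_cond_exp_pythagoras:
  fixes Y h :: "'a \<Rightarrow> real"
  assumes sub: "subalgebra M G" and Y [measurable]: "Y \<in> borel_measurable M"
    and Y2: "integrable M (\<lambda>\<omega>. (Y \<omega>)\<^sup>2)"
    and hG [measurable]: "h \<in> borel_measurable G" and h2: "integrable M (\<lambda>\<omega>. (h \<omega>)\<^sup>2)"
  defines "C \<equiv> real_cond_exp M G Y"
  shows "integrable M (\<lambda>\<omega>. (C \<omega> - h \<omega>)\<^sup>2)"
    and "(\<integral>\<omega>. (Y \<omega> - h \<omega>)\<^sup>2 \<partial>M) = (\<integral>\<omega>. (Y \<omega> - C \<omega>)\<^sup>2 \<partial>M) + (\<integral>\<omega>. (C \<omega> - h \<omega>)\<^sup>2 \<partial>M)"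
proof -
  interpret finite_measure_subalgebra M G
    by unfold_locales (rule sub)
  have [measurable]: "h \<in> borel_measurable M"
    by (rule measurable_from_subalg[OF sub hG])
  have CG [measurable]: "C \<in> borel_measurable G" and [measurable]: "C \<in> borel_measurable M"
    unfolding C_def by auto
  have C2: "integrable M (\<lambda>\<omega>. (C \<omega>)\<^sup>2)"
    unfolding C_def by (rule real_cond_exp_L2[OF sub Y Y2])
  have diff2: "integrable M (\<lambda>\<omega>. (u \<omega> - v \<omega>)\<^sup>2)"
    if [measurable]: "u \<in> borel_measurable M" "v \<in> borel_measurable M"
      and "integrable M (\<lambda>\<omega>. (u \<omega>)\<^sup>2)" "integrable M (\<lambda>\<omega>. (v \<omega>)\<^sup>2)" for u v :: "'a \<Rightarrow> real"
    using that integrable_mult_L2[OF that] by (simp add: power2_diff mult.assoc)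
  show Ch2: "integrable M (\<lambda>\<omega>. (C \<omega> - h \<omega>)\<^sup>2)"
    using C2 h2 by (intro diff2) auto
  have YC2: "integrable M (\<lambda>\<omega>. (Y \<omega> - C \<omega>)\<^sup>2)"
    using C2 Y2 by (intro diff2) auto
  have iY: "integrable M (\<lambda>\<omega>. (C \<omega> - h \<omega>) * Y \<omega>)"
    using Ch2 Y2 by (intro integrable_mult_L2) auto
  have iC: "integrable M (\<lambda>\<omega>. (C \<omega> - h \<omega>) * C \<omega>)"
    using Ch2 C2 by (intro integrable_mult_L2) auto
  \<comment> \<open>The error \<open>Y - C\<close> is orthogonal to the \<open>G\<close>-measurable function \<open>C - h\<close>; this is the
     defining property of the conditional expectation, with \<open>C - h\<close> as test function.\<close>
  have orth: "(\<integral>\<omega>. (C \<omega> - h \<omega>) * C \<omega> \<partial>M) = (\<integral>\<omega>. (C \<omega> - h \<omega>) * Y \<omega> \<partial>M)"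
    unfolding C_def by (rule real_cond_exp_intg(2)) (use iY in \<open>auto simp: C_def\<close>)
  define D where "D = (\<lambda>\<omega>. (C \<omega> - h \<omega>) * Y \<omega> - (C \<omega> - h \<omega>) * C \<omega>)"
  have D: "integrable M D" "(\<integral>\<omega>. D \<omega> \<partial>M) = 0"
    unfolding D_def using orth iY iC by simp_all
  have "(\<integral>\<omega>. (Y \<omega> - h \<omega>)\<^sup>2 \<partial>M) = (\<integral>\<omega>. ((Y \<omega> - C \<omega>)\<^sup>2 + (C \<omega> - h \<omega>)\<^sup>2) + 2 * D \<omega> \<partial>M)"
    by (intro Bochner_Integration.integral_cong)
       (auto simp: D_def power2_eq_square algebra_simps)
  also have "\<dots> = (\<integral>\<omega>. (Y \<omega> - C \<omega>)\<^sup>2 \<partial>M) + (\<integral>\<omega>. (C \<omega> - h \<omega>)\<^sup>2 \<partial>M)"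
    using YC2 Ch2 D by simp
  finally show "(\<integral>\<omega>. (Y \<omega> - h \<omega>)\<^sup>2 \<partial>M) = (\<integral>\<omega>. (Y \<omega> - C \<omega>)\<^sup>2 \<partial>M) + (\<integral>\<omega>. (C \<omega> - h \<omega>)\<^sup>2 \<partial>M)" .
qed

lemma Lf_space_2_iff:
  "Y \<in> Lf_space M H I f 2 \<longleftrightarrow>
    Y \<in> measurable H (restrict_space borel I) \<and> integrable M (\<lambda>\<omega>. (f (Y \<omega>))\<^sup>2)"
  by (simp add: Lf_space_def)

lemma f_dist_power2: "(f_dist M f X Y)\<^sup>2 = (\<integral>\<omega>. (f (X \<omega>) - f (Y \<omega>))\<^sup>2 \<partial>M)"
  by (simp add: f_dist_def)

lemma measurable_the_inv_into_strict_mono: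
  fixes f :: "real \<Rightarrow> real"
  assumes "strict_mono_on I f"
  shows "the_inv_into I f \<in> measurable (restrict_space borel (f ` I)) (restrict_space borel I)"
proof (rule measurable_restrict_space2)
  have inj: "inj_on f I"
    using assms by (rule strict_mono_on_imp_inj_on)
  then show "the_inv_into I f \<in> space (restrict_space borel (f ` I)) \<rightarrow> I"
    by (auto simp: space_restrict_space the_inv_into_f_f)
  have "mono_on (f ` I) (the_inv_into I f)"
    using assms inj by (auto simp: mono_on_def the_inv_into_f_f strict_mono_on_less_eq)
  then show "the_inv_into I f \<in> borel_measurable (restrict_space borel (f ` I))"
    by (rule borel_measurable_mono_on_fnc)
qed

theorem theorem3p1:
  fixes M G :: "'a measure" and I :: "real set" and f :: "real \<Rightarrow> real" and X :: "'a \<Rightarrow> real"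
  assumes "prob_space M"
    and "is_interval I"
    and "strict_mono_on I f"
    and "continuous_on I f"
    and "X \<in> Lf_space M M I f 2"
    and "subalgebra M G"
  shows "\<exists>Xs.
      is_arg_min (\<lambda>Y. (f_dist M f X Y)\<^sup>2) (\<lambda>Y. Y \<in> Lf_space M G I f 2) Xs
    \<and> (\<forall>Z. is_arg_min (\<lambda>Y. (f_dist M f X Y)\<^sup>2) (\<lambda>Y. Y \<in> Lf_space M G I f 2) Z
          \<longrightarrow> (AE \<omega> in M. Z \<omega> = Xs \<omega>))
    \<and> (AE \<omega> in M. real_cond_exp M G (\<lambda>\<omega>. f (X \<omega>)) \<omega> \<in> f ` I
          \<and> Xs \<omega> = the_inv_into I f (real_cond_exp M G (\<lambda>\<omega>. f (X \<omega>)) \<omega>))"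
proof -
  interpret prob_space M by fact
  note sub = assms(6)
  have inj: "inj_on f I"
    using assms(3) by (rule strict_mono_on_imp_inj_on)
  have f_meas: "f \<in> borel_measurable (restrict_space borel I)"
    using assms(4) by (rule borel_measurable_continuous_on_restrict)
  have J: "is_interval (f ` I)"
    using assms(2,4) by (simp add: is_interval_connected_1 connected_continuous_image)
  then have J_borel: "f ` I \<in> sets borel"
    by (simp add: is_interval_convex real_interval_borel_measurable)
  have X_meas: "X \<in> measurable M (restrict_space borel I)"
    and fX2: "integrable M (\<lambda>\<omega>. (f (X \<omega>))\<^sup>2)"
    using assms(5) by (auto simp: Lf_space_2_iff)
  have X_in: "X \<omega> \<in> I" if "\<omega> \<in> space M" for \<omega>
    using measurable_space[OF X_meas that] by (simp add: space_restrict_space)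
  have fX_meas: "(\<lambda>\<omega>. f (X \<omega>)) \<in> borel_measurable M"
    by (rule measurable_compose[OF X_meas f_meas])
  define C where "C = real_cond_exp M G (\<lambda>\<omega>. f (X \<omega>))"
  have C_meas [measurable]: "C \<in> borel_measurable G" "C \<in> borel_measurable M"
    unfolding C_def by (auto simp: borel_measurable_cond_exp2)
  have C_in: "AE \<omega> in M. C \<omega> \<in> f ` I"
    unfolding C_def using square_integrable_imp_integrable[OF fX_meas fX2] X_in
    by (intro real_cond_exp_in_interval[OF sub J]) auto

  \<comment> \<open>\<open>C\<close> may leave \<open>f ` I\<close> on a null set, but a member of \<open>Lf_space\<close> must take values in \<open>I\<close>
     everywhere. On that null set \<open>C\<close> is replaced by the value of \<open>f\<close> at an arbitrary point of \<open>I\<close>;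
     this keeps \<open>G\<close>-measurability because \<open>f ` I\<close> is a Borel set.\<close>
  obtain \<omega>0 where "\<omega>0 \<in> space M"
    using not_empty by auto
  define x0 where "x0 = X \<omega>0"
  have x0: "x0 \<in> I"
    unfolding x0_def by (rule X_in) fact
  define Xs where "Xs = (\<lambda>\<omega>. the_inv_into I f (if C \<omega> \<in> f ` I then C \<omega> else f x0))"
  have Xs_meas: "Xs \<in> measurable G (restrict_space borel I)"
    unfolding Xs_def
  proof (rule measurable_compose[OF _ measurable_the_inv_into_strict_mono[OF assms(3)]])
    show "(\<lambda>\<omega>. if C \<omega> \<in> f ` I then C \<omega> else f x0) \<in> measurable G (restrict_space borel (f ` I))"
      using J_borel x0 by (intro measurable_restrict_space2) auto
  qed
  have Xs_eq: "AE \<omega> in M. Xs \<omega> = the_inv_into I f (C \<omega>)"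
    using C_in by eventually_elim (simp add: Xs_def)
  have fXs: "AE \<omega> in M. f (Xs \<omega>) = C \<omega>"
    using C_in by eventually_elim (simp add: Xs_def f_the_inv_into_f[OF inj])
  have fY_meas: "(\<lambda>\<omega>. f (Y \<omega>)) \<in> borel_measurable G"
    if "Y \<in> measurable G (restrict_space borel I)" for Y
    by (rule measurable_compose[OF that f_meas])
  have [measurable]: "(\<lambda>\<omega>. f (Xs \<omega>)) \<in> borel_measurable M"
    by (rule measurable_from_subalg[OF sub fY_meas[OF Xs_meas]])
  have "integrable M (\<lambda>\<omega>. (C \<omega>)\<^sup>2)"
    unfolding C_def by (rule real_cond_exp_L2[OF sub fX_meas fX2])
  moreover have "integrable M (\<lambda>\<omega>. (f (Xs \<omega>))\<^sup>2) = integrable M (\<lambda>\<omega>. (C \<omega>)\<^sup>2)"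
    using fXs by (intro integrable_cong_AE) auto
  ultimately have Xs_Lf: "Xs \<in> Lf_space M G I f 2"
    using Xs_meas by (simp add: Lf_space_2_iff)
  have dist_Xs: "(f_dist M f X Xs)\<^sup>2 = (\<integral>\<omega>. (f (X \<omega>) - C \<omega>)\<^sup>2 \<partial>M)"
    unfolding f_dist_power2 using fXs fX_meas by (intro integral_cong_AE) auto
  \<comment> \<open>The excess of a competitor \<open>Y\<close> over \<open>Xs\<close> is the squared \<open>L\<^sup>2\<close>-distance from \<open>f \<circ> Y\<close> to \<open>C\<close>.
     Its nonnegativity gives minimality of \<open>Xs\<close>, and its vanishing characterises the other minimisers.\<close>
  have gap: "integrable M (\<lambda>\<omega>. (C \<omega> - f (Y \<omega>))\<^sup>2)"
    "(f_dist M f X Y)\<^sup>2 = (f_dist M f X Xs)\<^sup>2 + (\<integral>\<omega>. (C \<omega> - f (Y \<omega>))\<^sup>2 \<partial>M)"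
    if "Y \<in> Lf_space M G I f 2" for Y
    using real_cond_exp_pythagoras[OF sub fX_meas fX2, of "\<lambda>\<omega>. f (Y \<omega>)"] fY_meas[of Y] that
    unfolding dist_Xs unfolding f_dist_power2 Lf_space_2_iff C_def by auto
  have le: "(f_dist M f X Xs)\<^sup>2 \<le> (f_dist M f X Y)\<^sup>2" if "Y \<in> Lf_space M G I f 2" for Y
    using gap(2)[OF that] by simp
  have min: "is_arg_min (\<lambda>Y. (f_dist M f X Y)\<^sup>2) (\<lambda>Y. Y \<in> Lf_space M G I f 2) Xs"
    using Xs_Lf le by (auto simp: is_arg_min_linorder)
  have unique: "AE \<omega> in M. Z \<omega> = Xs \<omega>"
    if "is_arg_min (\<lambda>Y. (f_dist M f X Y)\<^sup>2) (\<lambda>Y. Y \<in> Lf_space M G I f 2) Z" for Z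
  proof -
    have Z: "Z \<in> Lf_space M G I f 2" and "(f_dist M f X Z)\<^sup>2 \<le> (f_dist M f X Xs)\<^sup>2"
      using that Xs_Lf by (auto simp: is_arg_min_linorder)
    then have "(\<integral>\<omega>. (C \<omega> - f (Z \<omega>))\<^sup>2 \<partial>M) \<le> 0"
      using gap(2)[OF Z] by simp
    then have "(\<integral>\<omega>. (C \<omega> - f (Z \<omega>))\<^sup>2 \<partial>M) = 0"
      by (simp add: order_antisym)
    then have CZ: "AE \<omega> in M. (C \<omega> - f (Z \<omega>))\<^sup>2 = 0"
      using integral_nonneg_eq_0_iff_AE[OF gap(1)[OF Z]] by simp
    have Z_in: "Z \<omega> \<in> I" if "\<omega> \<in> space M" for \<omega>
      using Z measurable_space[of Z G "restrict_space borel I" \<omega>] that sub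
      by (auto simp: Lf_space_2_iff space_restrict_space subalgebra_def)
    from CZ Xs_eq AE_space show ?thesis
      by eventually_elim (simp add: the_inv_into_f_f[OF inj] Z_in)
  qed
  show ?thesis
    using min unique C_in Xs_eq unfolding C_def by (intro exI[of _ Xs]) auto
qed

end
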